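(* Let $n\ge 1$ be an integer and let $G\{P_n(m)\}$ be the generating function of the sequence $P_n(m)=m(m+1)\cdots(m+n-1)$, $m=0,1,2,\ldots$. Then $$G\{P_n(m)\}=\frac{n!\,x}{(1-x)^{n+1}} .$$
   Context: For a sequence $(a_m)_{m\ge 0}$, $G\{a_m\}=\sum_{m=0}^{\infty}a_m x^m$ denotes its ordinary generating function, as a formal power series in $x$ (the index of the sequence being $m$). Note that $P_n(0)=0$. *)

theory Defs
  imports "HOL-Computational_Algebra.Formal_Power_Series"
begin

(* m (m+1) ... (m+n-1), a product of n factors over the natural numbers *)
definition P :: "nat \<Rightarrow> nat \<Rightarrow> nat" where
  "P n m = pochhammer m n"

end

theory Submission
  imports Defs
begin

text \<open>
  Multiplying a generating function by \<open>1 - x\<close> takes backward differences of its coefficients, and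
  rising factorials behave under differences as monomials do under derivatives: the difference of
  \<open>m (m+1) \<cdots> (m+n)\<close> is \<open>n + 1\<close> times the rising factorial with \<open>n\<close> factors. Hence each factor
  \<open>1 - x\<close> lowers the degree by one and releases one factor of \<open>n!\<close>
  (\<open>one_minus_X_times_gf_pochhammer\<close>). For \<open>n = 1\<close> two differences reduce the sequence
  \<open>0, 1, 2, \<dots>\<close> to \<open>0, 1, 0, 0, \<dots>\<close>, which is the \<open>x\<close> in the numerator.
\<close>

lemma fps_nth_one_minus_X_times:
  fixes F :: "'a::comm_ring_1 fps"
  shows "fps_nth ((1 - fps_X) * F) m =
           fps_nth F m - (if m = 0 then 0 else fps_nth F (m - 1))"
  by (simp add: left_diff_distrib)

text \<open>
  The products at \<open>z + 1\<close> and at \<open>z\<close> share the factors \<open>z + 1, \<dots>, z + n\<close>; the remaining factors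
  \<open>z + 1 + n\<close> and \<open>z\<close> differ by \<open>n + 1\<close>.
\<close>

lemma pochhammer_difference:
  fixes z :: "'a::comm_ring_1"
  shows "pochhammer (z + 1) (Suc n) - pochhammer z (Suc n) =
           of_nat (Suc n) * pochhammer (z + 1) n"
  unfolding pochhammer_rec'[of "z + 1"] pochhammer_rec[of z] by (simp add: algebra_simps)

text \<open>
  The constant coefficient on the right must vanish, as it does on the left; this forces
  \<open>n \<ge> 1\<close>, because the empty product is \<open>1\<close> even at \<open>m = 0\<close>.
\<close>

lemma one_minus_X_times_gf_pochhammer:
  assumes "n \<ge> 1"
  shows "(1 - fps_X) * Abs_fps (\<lambda>m. pochhammer (of_nat m) (Suc n)) =
           of_nat (Suc n) * (Abs_fps (\<lambda>m. pochhammer (of_nat m) n) :: 'a::comm_ring_1 fps)"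
proof (rule fps_ext)
  fix m
  show "fps_nth ((1 - fps_X) * Abs_fps (\<lambda>m. pochhammer (of_nat m) (Suc n))) m =
          fps_nth (of_nat (Suc n) * (Abs_fps (\<lambda>m. pochhammer (of_nat m) n) :: 'a fps)) m"
  proof (cases m)
    case 0
    with assms show ?thesis
      by (simp add: fps_nth_one_minus_X_times pochhammer_0_left del: of_nat_Suc)
  next
    case (Suc k)
    have "pochhammer (of_nat (Suc k)) (Suc n) - pochhammer (of_nat k) (Suc n) =
            of_nat (Suc n) * pochhammer (of_nat (Suc k) :: 'a) n"
      using pochhammer_difference[of "of_nat k :: 'a" n] by (simp only: of_nat_Suc add.commute)
    with Suc show ?thesis
      by (simp add: fps_nth_one_minus_X_times del: of_nat_Suc)
  qed
qed

lemma gf_pochhammer_times_power: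
  assumes "n \<ge> 1"
  shows "(1 - fps_X) ^ (n + 1) * Abs_fps (\<lambda>m. pochhammer (of_nat m) n) =
           (of_nat (fact n) * fps_X :: 'a::comm_ring_1 fps)"
  using assms
proof (induction n rule: dec_induct)
  case base
  show ?case
  proof (rule fps_ext)
    fix m
    show "fps_nth ((1 - fps_X) ^ (1 + 1) * Abs_fps (\<lambda>m. pochhammer (of_nat m) 1)) m =
            fps_nth (of_nat (fact 1) * fps_X :: 'a fps) m"
      by (cases m; cases "m - 1")
         (simp_all add: fps_nth_one_minus_X_times mult.assoc)
  qed
next
  case (step n)
  let ?G = "\<lambda>n. Abs_fps (\<lambda>m. pochhammer (of_nat m) n) :: 'a fps"
  have "(1 - fps_X) ^ (Suc n + 1) * ?G (Suc n) =
          (1 - fps_X) ^ (n + 1) * ((1 - fps_X) * ?G (Suc n))"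
    by (simp add: ac_simps)
  also have "\<dots> = of_nat (Suc n) * ((1 - fps_X) ^ (n + 1) * ?G n)"
    unfolding one_minus_X_times_gf_pochhammer[OF step.hyps(1)] by (simp only: ac_simps)
  also have "\<dots> = of_nat (fact (Suc n)) * fps_X"
    unfolding step.IH by (simp add: algebra_simps)
  finally show ?case .
qed

theorem theorem2p7:
  fixes n :: nat
  assumes "n \<ge> 1"
  shows "(Abs_fps (\<lambda>m. of_nat (P n m)) :: 'a::field_char_0 fps) =
           (fps_const (fact n) * fps_X) / (1 - fps_X) ^ (n + 1)"
proof -
  let ?G = "Abs_fps (\<lambda>m. of_nat (P n m)) :: 'a fps"
  let ?D = "(1 - fps_X) ^ (n + 1) :: 'a fps"
  have "?G * ?D = of_nat (fact n) * fps_X"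
    using gf_pochhammer_times_power[OF assms, where ?'a = 'a]
    by (simp only: P_def pochhammer_of_nat mult.commute)
  also have "\<dots> = fps_const (fact n) * fps_X"
    using fps_of_nat[of "fact n", where ?'a = 'a] by (simp only: of_nat_fact)
  finally have "?G * ?D = fps_const (fact n) * fps_X" .
  moreover have "?D \<noteq> 0"
  proof -
    have "fps_nth ?D 0 = 1"
      by (simp add: fps_nth_power_0)
    then show ?thesis
      by (metis fps_zero_nth zero_neq_one)
  qed
  ultimately show ?thesis
    by (metis nonzero_mult_div_cancel_right)
qed

end
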